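(* There are infinitely many, pairwise inequivalent up to scaling, trinomials $x^6+Ax+B$ with $A,B\in\mathbb{Q}$, $AB\neq0$, having reducibility type $(1,2,3)$. There are no trinomials $x^6+Ax+B$ with $A,B\in\mathbb{Q}$, $AB\neq0$, having reducibility type $(1,1,1,3)$.
   Context: A monic polynomial in $\mathbb{Q}[x]$ has reducibility type $(n_1,\dots,n_k)$, $n_1\le\dots\le n_k$, if it factors as a product of $k$ irreducible polynomials in $\mathbb{Q}[x]$ (not necessarily distinct) of degrees $n_1,\dots,n_k$. Two trinomials $x^n+Ax^m+B$ and $x^n+A'x^m+B'$ are equivalent up to scaling if $A'=A\lambda^{n-m}$ and $B'=B\lambda^n$ for some $\lambda\in\mathbb{Q}\setminus\{0\}$. *)

theory Defs
  imports "HOL-Computational_Algebra.Computational_Algebra"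
begin

definition trinomial :: "nat \<Rightarrow> nat \<Rightarrow> rat \<Rightarrow> rat \<Rightarrow> rat poly" where
  "trinomial n m A B = monom 1 n + monom A m + [:B:]"

text \<open>
  The irreducible factors are listed with multiplicity, in an order matching the
  non-decreasing list of degrees. They need not be monic: rescaling them by nonzero
  constants changes neither irreducibility nor degrees.
\<close>
definition has_reducibility_type :: "rat poly \<Rightarrow> nat list \<Rightarrow> bool" where
  "has_reducibility_type p ns \<longleftrightarrow>
     lead_coeff p = 1 \<and> sorted ns \<and>
     (\<exists>fs. p = prod_list fs \<and> (\<forall>f \<in> set fs. irreducible f) \<and> map degree fs = ns)"

text \<open>
  Equivalence up to scaling of \<open>trinomial n m A B\<close> and \<open>trinomial n m A' B'\<close>, expressed on
  the coefficients, which for \<open>0 < m < n\<close> are determined by the trinomials. The natural-number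
  subtraction \<open>n - m\<close> is meant for \<open>m \<le> n\<close>.
\<close>
definition scaling_equivalent ::
  "nat \<Rightarrow> nat \<Rightarrow> rat \<Rightarrow> rat \<Rightarrow> rat \<Rightarrow> rat \<Rightarrow> bool" where
  "scaling_equivalent n m A B A' B' \<longleftrightarrow>
     (\<exists>l. l \<noteq> 0 \<and> A' = A * l ^ (n - m) \<and> B' = B * l ^ n)"

end

theory Submission
  imports Defs "HOL-Number_Theory.Cong"
begin

text \<open>
  After scaling, a rational root may be taken to be 1, and the trinomial divided by \<open>x - 1\<close> is
  \<open>x^5 + x^4 + x^3 + x^2 + x + C\<close>. It is divisible by \<open>x^2 + a x + b\<close> for some \<open>C\<close> iff
  \<open>b^2 - b (3a^2 - 2a + 1) + (a^4 - a^3 + a^2 - a + 1) = 0\<close>. The discriminant in \<open>b\<close> is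
  \<open>(a - 1) (5a^3 - 3a^2 + 3a + 3)\<close>, and \<open>a = 1 + 2 / (x - 1)\<close> turns it, up to squares, into
  \<open>x^3 + 3x + 1\<close>. So the factorizations come from rational points of \<open>y^2 = x^3 + 3x + 1\<close>. The map
  \<open>P \<mapsto> -2P\<close>, started at \<open>(9/4, 35/8)\<close>, lowers the 2-adic valuation of \<open>x\<close> by 2 at each step and
  preserves \<open>(x, y) \<equiv> (0, 1)\<close> modulo 3. The first fact gives infinitely many points; the second one
  gives \<open>a \<equiv> b \<equiv> 2\<close> modulo 3, whence neither the quadratic nor the cubic factor has a root modulo 3.
  The rational root 1 is then unique, so two such trinomials are equivalent only if they are equal,
  and by unique factorization the trinomial determines \<open>(a, b)\<close>.

  If \<open>r, s, t\<close> are three roots, counted with multiplicity, the vanishing of the coefficients of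
  \<open>x^2, \<dots>, x^5\<close> forces the complete homogeneous symmetric polynomial \<open>h\<^sub>4(r, s, t)\<close> to vanish; as
  \<open>h\<^sub>4\<close> is positive definite, \<open>r = s = t = 0\<close> and hence \<open>B = 0\<close>.
\<close>

section \<open>Congruences between rationals and integers\<close>

text \<open>The denominator need not be reduced, but it has to be prime to the modulus.\<close>
definition rat_cong :: "int \<Rightarrow> rat \<Rightarrow> int \<Rightarrow> bool" where
  "rat_cong p x i \<longleftrightarrow>
     (\<exists>m n. coprime n p \<and> n \<noteq> 0 \<and> x = of_int m / of_int n \<and> [m = i * n] (mod p))"

lemma rat_cong_of_int: "rat_cong p (of_int i) i"
  unfolding rat_cong_def by (rule exI[of _ i], rule exI[of _ 1]) simp

lemma rat_cong_numeral: "rat_cong p (numeral k) (numeral k)"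
  using rat_cong_of_int[of p "numeral k"] by simp

lemma rat_cong_one: "rat_cong p 1 1"
  using rat_cong_of_int[of p 1] by simp

lemma rat_cong_trans:
  assumes "rat_cong p x i" "[i = j] (mod p)"
  shows "rat_cong p x j"
proof -
  obtain m n where "coprime n p" "n \<noteq> 0" "x = of_int m / of_int n" "[m = i * n] (mod p)"
    using assms(1) unfolding rat_cong_def by blast
  moreover have "[i * n = j * n] (mod p)"
    using assms(2) by (rule cong_scalar_right)
  ultimately show ?thesis
    unfolding rat_cong_def by (intro exI[of _ m] exI[of _ n]) (auto intro: cong_trans)
qed

lemma rat_cong_uminus:
  assumes "rat_cong p x i"
  shows "rat_cong p (- x) (- i)"
proof -
  obtain m n where "coprime n p" "n \<noteq> 0" "x = of_int m / of_int n" "[m = i * n] (mod p)"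
    using assms unfolding rat_cong_def by blast
  then show ?thesis
    unfolding rat_cong_def
    by (intro exI[of _ "- m"] exI[of _ n]) (simp add: cong_minus_minus_iff)
qed

lemma rat_cong_add:
  assumes "rat_cong p x i" "rat_cong p y j"
  shows "rat_cong p (x + y) (i + j)"
proof -
  obtain m n where mn: "coprime n p" "n \<noteq> 0" "x = of_int m / of_int n" "[m = i * n] (mod p)"
    using assms unfolding rat_cong_def by blast
  obtain k l where kl: "coprime l p" "l \<noteq> 0" "y = of_int k / of_int l" "[k = j * l] (mod p)"
    using assms unfolding rat_cong_def by blast
  have "[m * l + k * n = (i * n) * l + (j * l) * n] (mod p)"
    using mn kl by (intro cong_add cong_mult) auto
  then show ?thesis
    unfolding rat_cong_def using mn kl
    by (intro exI[of _ "m * l + k * n"] exI[of _ "n * l"]) (auto simp: field_simps)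
qed

lemma rat_cong_diff:
  assumes "rat_cong p x i" "rat_cong p y j"
  shows "rat_cong p (x - y) (i - j)"
  using rat_cong_add[OF assms(1) rat_cong_uminus[OF assms(2)]] by simp

lemma rat_cong_mult:
  assumes "rat_cong p x i" "rat_cong p y j"
  shows "rat_cong p (x * y) (i * j)"
proof -
  obtain m n where mn: "coprime n p" "n \<noteq> 0" "x = of_int m / of_int n" "[m = i * n] (mod p)"
    using assms unfolding rat_cong_def by blast
  obtain k l where kl: "coprime l p" "l \<noteq> 0" "y = of_int k / of_int l" "[k = j * l] (mod p)"
    using assms unfolding rat_cong_def by blast
  have "[m * k = (i * n) * (j * l)] (mod p)"
    using mn kl by (intro cong_mult) auto
  then show ?thesis
    unfolding rat_cong_def using mn kl
    by (intro exI[of _ "m * k"] exI[of _ "n * l"]) (auto simp: mult_ac)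
qed

lemma rat_cong_power: "rat_cong p x i \<Longrightarrow> rat_cong p (x ^ k) (i ^ k)"
  by (induction k) (auto intro: rat_cong_one rat_cong_mult)

text \<open>Writing \<open>y = k / l\<close>, the invertibility of \<open>j\<close> makes
  \<open>k\<close> prime to \<open>p\<close>, so \<open>l / k\<close> is an admissible fraction for
  \<open>1 / y\<close>, with residue \<open>j'\<close>.\<close>

lemma rat_cong_divide:
  assumes x: "rat_cong p x i" and y: "rat_cong p y j" and j: "[j * j' = 1] (mod p)"
    and "y \<noteq> 0"
  shows "rat_cong p (x / y) (i * j')"
proof -
  obtain k l where kl: "coprime l p" "l \<noteq> 0" "y = of_int k / of_int l" "[k = j * l] (mod p)"
    using y unfolding rat_cong_def by blast
  have "coprime j p"
    using j by (metis coprime_iff_invertible_int)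
  then have "coprime k p"
    using kl by (metis cong_imp_coprime cong_sym coprime_mult_left_iff)
  moreover have "[l = j' * k] (mod p)"
  proof -
    have "[j' * k = j' * (j * l)] (mod p)"
      using kl by (intro cong_mult) auto
    moreover have "[(j * j') * l = 1 * l] (mod p)"
      using j by (intro cong_mult) auto
    ultimately show ?thesis
      by (metis cong_sym cong_trans mult.assoc mult.commute mult_1)
  qed
  ultimately have "rat_cong p (1 / y) j'"
    unfolding rat_cong_def using kl assms(4) by (intro exI[of _ l] exI[of _ k]) auto
  from rat_cong_mult[OF x this] show ?thesis by simp
qed

lemmas rat_cong_intros =
  rat_cong_add rat_cong_diff rat_cong_mult rat_cong_power rat_cong_numeral rat_cong_one

lemma rat_cong_zeroD:
  assumes "rat_cong p 0 i"
  shows "p dvd i"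
proof -
  obtain m n where mn: "coprime n p" "n \<noteq> 0" "0 = (of_int m / of_int n :: rat)" "[m = i * n] (mod p)"
    using assms unfolding rat_cong_def by blast
  then have "p dvd i * n"
    by (auto simp: cong_def mod_0_imp_dvd)
  then show ?thesis
    using mn(1) by (simp add: coprime_commute coprime_dvd_mult_left_iff)
qed

text \<open>Reduction of the projective line: a rational reduces to a residue or to infinity, and in
  the second case its inverse reduces to 0.\<close>

lemma rat_cong_cases:
  assumes "prime p"
  obtains i where "0 \<le> i" "i < p" "rat_cong p r i" | "r \<noteq> 0" "rat_cong p (1 / r) 0"
proof -
  obtain m n where r: "r = of_int m / of_int n" "n > 0" "coprime m n"
    by (metis quotient_of_div quotient_of_denom_pos quotient_of_coprime surj_pair)
  show thesis
  proof (cases "coprime n p")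
    case True
    then obtain n' where n': "[n * n' = 1] (mod p)"
      by (metis coprime_iff_invertible_int)
    have "[m * n' * n = m] (mod p)"
      using cong_scalar_left[OF n', of m] by (simp add: mult_ac)
    then have "[m = (m * n' mod p) * n] (mod p)"
      by (metis cong_def mod_mult_left_eq)
    then have "rat_cong p r (m * n' mod p)"
      unfolding rat_cong_def using True r by (intro exI[of _ m] exI[of _ n]) auto
    with that(1) show ?thesis
      using assms by (meson pos_mod_bound pos_mod_sign prime_gt_0_int)
  next
    case False
    then have "p dvd n"
      using assms by (metis coprime_commute prime_imp_coprime)
    then have "coprime m p"
      using r(3) by (meson coprime_divisors dvd_refl)
    then have "m \<noteq> 0"
      using assms by (metis coprime_0_left_iff not_prime_unit)
    show ?thesis
    proof (rule that(2))
      show "r \<noteq> 0" using r \<open>m \<noteq> 0\<close> by simp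
      show "rat_cong p (1 / r) 0"
        unfolding rat_cong_def using r \<open>m \<noteq> 0\<close> \<open>coprime m p\<close> \<open>p dvd n\<close>
        by (intro exI[of _ n] exI[of _ m]) (auto simp: cong_0_iff)
    qed
  qed
qed

section \<open>Rational points on y^2 = x^3 + 3x + 1\<close>

text \<open>The tangent formulas for duplication: \<open>x'\<close> and \<open>y'\<close> are the
  coordinates of 2P for P = (x, y).\<close>

lemma elliptic_curve_double:
  fixes x y :: rat
  assumes "y ^ 2 = x ^ 3 + 3 * x + 1" "y \<noteq> 0"
  defines "x' \<equiv> (x ^ 4 - 6 * x ^ 2 - 8 * x + 9) / (4 * (x ^ 3 + 3 * x + 1))"
    and "y' \<equiv> (x ^ 6 + 15 * x ^ 4 + 20 * x ^ 3 - 45 * x ^ 2 - 12 * x - 35) / (8 * y ^ 3)"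
  shows "y' ^ 2 = x' ^ 3 + 3 * x' + 1"
proof -
  define F where "F = x ^ 4 - 6 * x ^ 2 - 8 * x + 9"
  define W where "W = x ^ 3 + 3 * x + 1"
  define N where "N = x ^ 6 + 15 * x ^ 4 + 20 * x ^ 3 - 45 * x ^ 2 - 12 * x - 35"
  have W: "W \<noteq> 0" "W = y ^ 2"
    using assms(1,2) unfolding W_def by auto
  \<comment> \<open>The curve equation at \<open>F / (4 * W)\<close>, multiplied by
    \<open>64 * W ^ 3\<close>.\<close>
  have N: "N ^ 2 = F ^ 3 + 48 * F * W ^ 2 + 64 * W ^ 3"
    unfolding N_def F_def W_def by algebra
  have "y' ^ 2 = N ^ 2 / (64 * W ^ 3)"
    unfolding y'_def N_def[symmetric] W(2) by (simp add: power_divide power_mult_distrib flip: power_mult)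
  also have "\<dots> = (F / (4 * W)) ^ 3 + 3 * (F / (4 * W)) + 1"
    unfolding N using W(1) by (simp add: power_divide power_mult_distrib field_simps power2_eq_square power3_eq_cube)
  finally show ?thesis
    unfolding x'_def F_def W_def .
qed

lemma ex_points_2adic:
  "\<exists>(x :: rat) y (r :: int) s. y ^ 2 = x ^ 3 + 3 * x + 1 \<and> rat_cong 3 x 0 \<and> rat_cong 3 y 1 \<and>
     odd r \<and> odd s \<and> x = of_int r / of_int (4 ^ Suc n * s)"
proof (induction n)
  case 0
  \<comment> \<open>The factors 1 and 2 are the inverses of 4 and 8 modulo 3.\<close>
  have "rat_cong 3 (9 / 4) (9 * 1)" "rat_cong 3 (35 / 8) (35 * 2)"
    by (rule rat_cong_divide[OF rat_cong_numeral rat_cong_numeral]; simp add: cong_def)+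
  then have "rat_cong 3 (9 / 4) 0" "rat_cong 3 (35 / 8) 1"
    by (auto elim!: rat_cong_trans simp: cong_def)
  then show ?case
    by (intro exI[of _ "9/4"] exI[of _ "35/8"] exI[of _ 9] exI[of _ 1]) (simp add: power_divide)
next
  case (Suc n)
  then obtain x y :: rat and r s :: int where
    xy: "y ^ 2 = x ^ 3 + 3 * x + 1" and x: "rat_cong 3 x 0" and y: "rat_cong 3 y 1"
    and rs: "odd r" "odd s" "x = of_int r / of_int (4 ^ Suc n * s)"
    by blast
  have y0: "y \<noteq> 0"
    using y rat_cong_zeroD[of 3 1] by auto
  define W where "W = x ^ 3 + 3 * x + 1"
  have W0: "W \<noteq> 0" using xy y0 W_def by auto
  define x' where "x' = (x ^ 4 - 6 * x ^ 2 - 8 * x + 9) / (4 * (x ^ 3 + 3 * x + 1))"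
  define y' where "y' = (x ^ 6 + 15 * x ^ 4 + 20 * x ^ 3 - 45 * x ^ 2 - 12 * x - 35) / (8 * y ^ 3)"
  have "y' ^ 2 = x' ^ 3 + 3 * x' + 1"
    unfolding x'_def y'_def by (rule elliptic_curve_double[OF xy y0])
  \<comment> \<open>The sign is changed, giving -2P, because \<open>y'\<close> is congruent to 2
    modulo 3.\<close>
  then have curve: "(- y') ^ 2 = x' ^ 3 + 3 * x' + 1" by simp
  have "rat_cong 3 x' ((0 ^ 4 - 6 * 0 ^ 2 - 8 * 0 + 9) * 1)"
    unfolding x'_def
    by (rule rat_cong_divide[where j = "4 * (0 ^ 3 + 3 * 0 + 1)"])
      (intro rat_cong_intros x, intro rat_cong_intros x, simp add: cong_def, use W0 W_def in simp)
  then have x'0: "rat_cong 3 x' 0"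
    by (rule rat_cong_trans) (simp add: cong_def)
  have "rat_cong 3 y' ((0 ^ 6 + 15 * 0 ^ 4 + 20 * 0 ^ 3 - 45 * 0 ^ 2 - 12 * 0 - 35) * 2)"
    unfolding y'_def
    by (rule rat_cong_divide[where j = "8 * 1 ^ 3"])
      (intro rat_cong_intros x, intro rat_cong_intros y, simp add: cong_def, use y0 in simp)
  from rat_cong_uminus[OF this] have y'1: "rat_cong 3 (- y') 1"
    by (rule rat_cong_trans) (simp add: cong_def)
  define q where "q = 4 ^ Suc n * s"
  have q: "even q" "q \<noteq> 0" "x = of_int r / of_int q"
    unfolding q_def using rs by auto
  define v where "v = r ^ 3 + 3 * r * q ^ 2 + q ^ 3"
  define w where "w = r ^ 4 - 6 * r ^ 2 * q ^ 2 - 8 * r * q ^ 3 + 9 * q ^ 4"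
  \<comment> \<open>As \<open>q\<close> is even, only the pure powers of \<open>r\<close> count
    modulo 2. Hence the power of 2 in the denominator grows by exactly 4.\<close>
  have odd: "odd v" "odd w"
    unfolding v_def w_def using rs q by auto
  then have v0: "v \<noteq> 0" by auto
  have v: "x ^ 3 + 3 * x + 1 = of_int v / of_int q ^ 3"
    unfolding v_def q(3) using q(2) by (simp add: field_simps power2_eq_square power3_eq_cube)
  have w: "x ^ 4 - 6 * x ^ 2 - 8 * x + 9 = of_int w / of_int q ^ 4"
    unfolding w_def q(3) using q(2) by (simp add: field_simps eval_nat_numeral)
  have "x' = of_int w / of_int (4 * q * v)"
    unfolding x'_def v w using q(2) v0 by (simp add: field_simps eval_nat_numeral)
  also have "4 * q * v = 4 ^ Suc (Suc n) * (s * v)"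
    unfolding q_def by simp
  finally show ?case
    using curve x'0 y'1 odd rs(2) by (metis even_mult_iff)
qed

section \<open>Factorizations from points on the curve\<close>

definition splitting_pair :: "rat \<Rightarrow> rat \<Rightarrow> bool" where
  "splitting_pair a b \<longleftrightarrow> rat_cong 3 a 2 \<and> rat_cong 3 b 2 \<and>
     b ^ 2 - b * (3 * a ^ 2 - 2 * a + 1) + (a ^ 4 - a ^ 3 + a ^ 2 - a + 1) = 0"

lemma splitting_pair_of_point:
  fixes x y :: rat
  assumes xy: "y ^ 2 = x ^ 3 + 3 * x + 1" and x: "rat_cong 3 x 0" and y: "rat_cong 3 y 1"
  shows "\<exists>b. splitting_pair (1 + 2 / (x - 1)) b"
proof -
  have x1: "x - 1 \<noteq> 0"
    using rat_cong_zeroD[of 3 "0 - 1"] rat_cong_diff[OF x rat_cong_one] by auto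
  define u where "u = 2 / (x - 1)"
  have u0: "u \<noteq> 0" and xu: "x = 1 + 2 / u"
    using x1 unfolding u_def by (auto simp: field_simps)
  have "rat_cong 3 u (2 * 2)"
    unfolding u_def by (rule rat_cong_divide[where j = "0 - 1"])
      (intro rat_cong_intros x, intro rat_cong_intros x, simp add: cong_def, use x1 in simp)
  then have u: "rat_cong 3 u 1"
    by (rule rat_cong_trans) (simp add: cong_def)
  \<comment> \<open>The quadratic formula with a = 1 + u: 3a^2 - 2a + 1 becomes 2 + 4u + 3u^2, and
    \<open>y * u ^ 2\<close> is a square root of the discriminant. The plus sign gives residue 2
    modulo 3; the minus sign would give 1.\<close>
  define b where "b = (2 + 4 * u + 3 * u ^ 2 + y * u ^ 2) / 2"
  have "rat_cong 3 b ((2 + 4 * 1 + 3 * 1 ^ 2 + 1 * 1 ^ 2) * 2)"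
    unfolding b_def by (rule rat_cong_divide[where j = 2])
      (intro rat_cong_intros u y, intro rat_cong_intros x, simp_all add: cong_def)
  then have b2: "rat_cong 3 b 2"
    by (rule rat_cong_trans) (simp add: cong_def)
  have a2: "rat_cong 3 (1 + u) 2"
    using rat_cong_add[OF rat_cong_one u] by simp
  have "(y * u ^ 2) ^ 2 = u ^ 4 * (x ^ 3 + 3 * x + 1)"
    by (simp add: power_mult_distrib xy flip: power_mult)
  also have "\<dots> = u * (8 + 12 * u + 12 * u ^ 2 + 5 * u ^ 3)"
    unfolding xu using u0 by (simp add: field_simps eval_nat_numeral)
  finally have Y: "(y * u ^ 2) ^ 2 = u * (8 + 12 * u + 12 * u ^ 2 + 5 * u ^ 3)" .
  define z where "z = y * u ^ 2"
  have b: "2 * b = 2 + 4 * u + 3 * u ^ 2 + z"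
    unfolding b_def z_def by simp
  have "4 * (b ^ 2 - b * (3 * (1 + u) ^ 2 - 2 * (1 + u) + 1)
      + ((1 + u) ^ 4 - (1 + u) ^ 3 + (1 + u) ^ 2 - (1 + u) + 1)) = 0"
    using b Y[folded z_def] by algebra
  then have "splitting_pair (1 + u) b"
    unfolding splitting_pair_def using a2 b2 by simp
  then show ?thesis
    unfolding u_def by blast
qed

lemma infinite_splitting_pairs:
  "infinite {(a, b). splitting_pair a b}"
proof -
  obtain X Y r s where XY: "\<And>n. (Y n :: rat) ^ 2 = X n ^ 3 + 3 * X n + 1"
    "\<And>n. rat_cong 3 (X n) 0" "\<And>n. rat_cong 3 (Y n) 1"
    "\<And>n. odd (r n :: int)" "\<And>n. odd (s n :: int)"
    "\<And>n :: nat. X n = of_int (r n) / of_int (4 ^ Suc n * s n)"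
    using ex_points_2adic by metis
  have ne: "X m \<noteq> X n" if "m < n" for m n
  proof
    assume "X m = X n"
    have nz: "s m \<noteq> 0" "s n \<noteq> 0"
      using XY(5) by (metis even_zero)+
    have "4 ^ Suc n = (4 :: int) ^ Suc m * 4 ^ (n - m)"
      using that by (metis add_Suc le_add_diff_inverse less_imp_le power_add)
    then have "(of_int (r m) :: rat) * (of_int (4 ^ (n - m) * s n)) = of_int (r n) * of_int (s m)"
      using \<open>X m = X n\<close> nz unfolding XY(6) by (simp add: field_simps)
    \<comment> \<open>The left side is even since m < n, the right side odd.\<close>
    then have "r m * (4 ^ (n - m) * s n) = r n * s m"
      by (metis of_int_eq_iff of_int_mult)
    then show False
      using XY(4,5)[of n] XY(5)[of m] that
      by (metis even_mult_iff even_numeral even_power zero_less_diff)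
  qed
  then have "inj X"
    by (metis injI linorder_neqE_nat)
  have X1: "X n \<noteq> 1" for n
    using rat_cong_zeroD[of 3 "0 - 1"] rat_cong_diff[OF XY(2)[of n] rat_cong_one] by auto
  have "inj (\<lambda>n. 1 + 2 / (X n - 1))"
    using \<open>inj X\<close> X1 by (auto simp: inj_def field_simps)
  then have "infinite (range (\<lambda>n. 1 + 2 / (X n - 1)))"
    by (rule range_inj_infinite)
  moreover have "range (\<lambda>n. 1 + 2 / (X n - 1)) \<subseteq> fst ` {(a, b). splitting_pair a b}"
    using splitting_pair_of_point[OF XY(1-3)] by (force simp: image_iff)
  ultimately show ?thesis
    using finite_surj by blast
qed

section \<open>Irreducibility of the quadratic and cubic factors\<close>

text \<open>In these degrees a proper factorization contains a linear factor, hence a root in the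
  field.\<close>

lemma irreducible_if_no_root:
  fixes p :: "'a :: field poly"
  assumes deg: "degree p \<in> {2, 3}" and root: "\<And>x. poly p x \<noteq> 0"
  shows "irreducible p"
proof (rule irreducibleI)
  have lin: False if q1: "degree q = 1" and "q dvd p" for q
  proof -
    obtain c d where "q = [:c, d:]" "d \<noteq> 0"
      using degree1_coeffs[OF q1] .
    then have "poly q (- c / d) = 0"
      by (simp add: field_simps)
    then have "poly p (- c / d) = 0"
      using \<open>q dvd p\<close> by (auto elim!: dvdE)
    then show False
      using root by blast
  qed
  show p0: "p \<noteq> 0" using deg by auto
  show "\<not> p dvd 1" using deg by (auto simp: is_unit_iff_degree p0)
  fix f g assume fg: "p = f * g"
  then have nz: "f \<noteq> 0" "g \<noteq> 0" using p0 by auto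
  then have "degree p = degree f + degree g"
    using fg by (simp add: degree_mult_eq)
  moreover have "degree f \<noteq> 1" "degree g \<noteq> 1"
    using lin[of f] lin[of g] unfolding fg by (metis dvd_triv_left, metis dvd_triv_right)
  ultimately have "degree f = 0 \<or> degree g = 0"
    using deg by auto
  then show "f dvd 1 \<or> g dvd 1"
    using nz by (simp add: is_unit_iff_degree)
qed

text \<open>
  The coefficients of the cubic cofactor are determined by those of \<open>x^4, x^3, x^2\<close> in the quintic;
  the coefficient of \<open>x\<close> yields the equation in \<open>splitting_pair\<close>.
\<close>
definition quad :: "rat \<Rightarrow> rat \<Rightarrow> rat poly" where
  "quad a b = [:b, a, 1:]"

definition cubic_const :: "rat \<Rightarrow> rat \<Rightarrow> rat" where
  "cubic_const a b = 1 - b - a + 2 * a * b + a ^ 2 - a ^ 3"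

definition cubic :: "rat \<Rightarrow> rat \<Rightarrow> rat poly" where
  "cubic a b = [:cubic_const a b, 1 - b - a + a ^ 2, 1 - a, 1:]"

text \<open>Modulo 3 the quadratic is x^2 + 2x + 2, with values 2, 2, 1 at 0, 1, 2.\<close>

lemma quad_no_root:
  assumes "splitting_pair a b"
  shows "poly (quad a b) r \<noteq> 0"
proof
  assume "poly (quad a b) r = 0"
  then have z: "r ^ 2 + a * r + b = 0"
    unfolding quad_def by (simp add: algebra_simps power2_eq_square)
  have a: "rat_cong 3 a 2" and b: "rat_cong 3 b 2"
    using assms unfolding splitting_pair_def by auto
  show False
  proof (rule rat_cong_cases[of 3 r])
    show "prime (3 :: int)" by simp
  next
    fix i :: int assume i: "0 \<le> i" "i < 3" "rat_cong 3 r i"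
    have "rat_cong 3 (r ^ 2 + a * r + b) (i ^ 2 + 2 * i + 2)"
      by (intro rat_cong_intros a b i)
    then have "3 dvd i ^ 2 + 2 * i + 2"
      using z rat_cong_zeroD by simp
    moreover have "i \<in> {0, 1, 2}" using i by auto
    ultimately show False by auto
  next
    assume r: "r \<noteq> 0" "rat_cong 3 (1 / r) 0"
    \<comment> \<open>At infinity the reversed polynomial is used: its constant term is 1, so its
      value at \<open>1 / r\<close> is 1 modulo 3.\<close>
    have "1 + a * (1 / r) + b * (1 / r) ^ 2 = (r ^ 2 + a * r + b) / r ^ 2"
      using r(1) by (simp add: field_simps power2_eq_square)
    also have "\<dots> = 0" using z by simp
    finally have "1 + a * (1 / r) + b * (1 / r) ^ 2 = 0" .
    moreover have "rat_cong 3 (1 + a * (1 / r) + b * (1 / r) ^ 2) (1 + 2 * 0 + 2 * 0 ^ 2)"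
      by (intro rat_cong_intros a b r)
    ultimately show False
      using rat_cong_zeroD[of 3 "1 + 2 * 0 + 2 * 0 ^ 2"] by simp
  qed
qed

text \<open>Modulo 3 the cubic is x^3 - x^2 + x + 1, with values 1, 2, 1 at 0, 1, 2.\<close>

lemma cubic_no_root:
  assumes "splitting_pair a b"
  shows "poly (cubic a b) r \<noteq> 0"
proof
  define c d e where "c = 1 - a" and "d = 1 - b - a + a ^ 2" and "e = cubic_const a b"
  assume "poly (cubic a b) r = 0"
  then have z: "r ^ 3 + c * r ^ 2 + d * r + e = 0"
    unfolding cubic_def c_def d_def e_def by (simp add: algebra_simps power2_eq_square power3_eq_cube)
  have a: "rat_cong 3 a 2" and b: "rat_cong 3 b 2"
    using assms unfolding splitting_pair_def by auto
  have c: "rat_cong 3 c (1 - 2)" and d: "rat_cong 3 d (1 - 2 - 2 + 2 ^ 2)"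
    and e: "rat_cong 3 e (1 - 2 - 2 + 2 * 2 * 2 + 2 ^ 2 - 2 ^ 3)"
    unfolding c_def d_def e_def cubic_const_def by (intro rat_cong_intros a b)+
  show False
  proof (rule rat_cong_cases[of 3 r])
    show "prime (3 :: int)" by simp
  next
    fix i :: int assume i: "0 \<le> i" "i < 3" "rat_cong 3 r i"
    have "rat_cong 3 (r ^ 3 + c * r ^ 2 + d * r + e)
      (i ^ 3 + (1 - 2) * i ^ 2 + (1 - 2 - 2 + 2 ^ 2) * i + (1 - 2 - 2 + 2 * 2 * 2 + 2 ^ 2 - 2 ^ 3))"
      by (intro rat_cong_intros c d e i)
    then have "3 dvd i ^ 3 + (1 - 2) * i ^ 2 + (1 - 2 - 2 + 2 ^ 2) * i + (1 - 2 - 2 + 2 * 2 * 2 + 2 ^ 2 - 2 ^ 3)"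
      using z rat_cong_zeroD by simp
    moreover have "i \<in> {0, 1, 2}" using i by auto
    ultimately show False by auto
  next
    assume r: "r \<noteq> 0" "rat_cong 3 (1 / r) 0"
    have "1 + c * (1 / r) + d * (1 / r) ^ 2 + e * (1 / r) ^ 3
        = (r ^ 3 + c * r ^ 2 + d * r + e) / r ^ 3"
      using r(1) by (simp add: field_simps power2_eq_square power3_eq_cube)
    also have "\<dots> = 0" using z by simp
    finally have "1 + c * (1 / r) + d * (1 / r) ^ 2 + e * (1 / r) ^ 3 = 0" .
    moreover have "rat_cong 3 (1 + c * (1 / r) + d * (1 / r) ^ 2 + e * (1 / r) ^ 3)
      (1 + (1 - 2) * 0 + (1 - 2 - 2 + 2 ^ 2) * 0 ^ 2 + (1 - 2 - 2 + 2 * 2 * 2 + 2 ^ 2 - 2 ^ 3) * 0 ^ 3)"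
      by (intro rat_cong_intros c d e r)
    ultimately show False
      by (auto dest: rat_cong_zeroD)
  qed
qed

lemma irreducible_quad: "splitting_pair a b \<Longrightarrow> irreducible (quad a b)"
  by (rule irreducible_if_no_root) (auto simp: quad_no_root, simp add: quad_def)

lemma irreducible_cubic: "splitting_pair a b \<Longrightarrow> irreducible (cubic a b)"
  by (rule irreducible_if_no_root) (auto simp: cubic_no_root, simp add: cubic_def)

section \<open>The family of trinomials with root 1\<close>

lemma trinomial_6_1: "trinomial 6 1 A B = [:B, A, 0, 0, 0, 0, 1:]"
  unfolding trinomial_def by (simp add: monom_altdef eval_nat_numeral)

text \<open>With C = \<open>b * cubic_const a b\<close>, the quintic x^5 + x^4 + x^3 + x^2 + x + C
  times x - 1 is x^6 + (C - 1) x - C.\<close>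

lemma trinomial_factorization:
  assumes "splitting_pair a b"
  shows "trinomial 6 1 (b * cubic_const a b - 1) (- (b * cubic_const a b))
    = [:-1, 1:] * (quad a b * cubic a b)"
proof -
  have "b ^ 2 - b * (3 * a ^ 2 - 2 * a + 1) + (a ^ 4 - a ^ 3 + a ^ 2 - a + 1) = 0"
    using assms unfolding splitting_pair_def by simp
  then have "b * (1 - b - a + a ^ 2) + a * cubic_const a b = 1"
    unfolding cubic_const_def by algebra
  then show ?thesis
    unfolding trinomial_6_1 quad_def cubic_def
    by (simp add: cubic_const_def algebra_simps power2_eq_square power3_eq_cube)
qed

lemma trinomial_root_unique:
  assumes "splitting_pair a b"
    and "poly (trinomial 6 1 (b * cubic_const a b - 1) (- (b * cubic_const a b))) x = 0"
  shows "x = 1"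
  using assms(2) quad_no_root[OF assms(1), of x] cubic_no_root[OF assms(1), of x]
  unfolding trinomial_factorization[OF assms(1)] by simp

text \<open>After cancelling x - 1, the prime quadratic cannot divide the irreducible cubic, so it
  divides the other quadratic; both being monic, they agree.\<close>

lemma splitting_pair_unique:
  assumes ab: "splitting_pair a b" and ab': "splitting_pair a' b'"
    and eq: "b * cubic_const a b = b' * cubic_const a' b'"
  shows "a = a' \<and> b = b'"
proof -
  have "[:-1, 1:] * (quad a b * cubic a b) = [:-1, 1:] * (quad a' b' * cubic a' b')"
    using trinomial_factorization[OF ab] trinomial_factorization[OF ab'] eq by metis
  then have e: "quad a b * cubic a b = quad a' b' * cubic a' b'"
    by (metis mult_left_cancel pCons_eq_0_iff one_neq_zero)
  have "prime_elem (quad a b)"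
    using irreducible_quad[OF ab] by (rule field_poly_irreducible_imp_prime)
  then have "quad a b dvd quad a' b' \<or> quad a b dvd cubic a' b'"
    using e by (metis dvd_triv_left prime_elem_dvd_mult_iff)
  moreover have "\<not> quad a b dvd cubic a' b'"
  proof
    assume "quad a b dvd cubic a' b'"
    then obtain g where g: "cubic a' b' = quad a b * g" by blast
    then have "g dvd 1"
      using irreducibleD[OF irreducible_cubic[OF ab'] g] irreducible_not_unit[OF irreducible_quad[OF ab]]
      by blast
    moreover from this have "g \<noteq> 0" by auto
    ultimately have "degree g = 0"
      by (simp add: is_unit_iff_degree)
    have "quad a b \<noteq> 0" by (simp add: quad_def)
    with \<open>g \<noteq> 0\<close> \<open>degree g = 0\<close> have "degree (cubic a' b') = degree (quad a b)"
      using g by (simp add: degree_mult_eq)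
    then show False
      by (simp add: cubic_def quad_def)
  qed
  ultimately obtain g where g: "quad a' b' = quad a b * g" by blast
  then have "g \<noteq> 0" "quad a b \<noteq> 0" by (auto simp: quad_def)
  then have "degree (quad a' b') = degree (quad a b) + degree g"
    using g by (simp add: degree_mult_eq)
  then have "degree g = 0" by (simp add: quad_def)
  then obtain k where "g = [:k:]" by (metis degree_0_id)
  then have "[:b', a', 1:] = [:b * k, a * k, k:]"
    using g unfolding quad_def by (simp add: mult_ac)
  then show ?thesis by simp
qed

section \<open>Exclusion of three rational roots\<close>

lemma complete_homogeneous_4_eq_0D:
  fixes r s t :: rat
  assumes "r ^ 4 + s ^ 4 + t ^ 4 + r ^ 3 * s + r ^ 3 * t + s ^ 3 * r + s ^ 3 * t + t ^ 3 * r + t ^ 3 * s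
    + r ^ 2 * s ^ 2 + r ^ 2 * t ^ 2 + s ^ 2 * t ^ 2 + r * s * t * (r + s + t) = 0"
  shows "r = 0"
proof -
  \<comment> \<open>In power sums, \<open>24 h\<^sub>4 = p\<^sub>1^4 + 6 p\<^sub>1^2 p\<^sub>2 + 3 p\<^sub>2^2 + 8 p\<^sub>1 p\<^sub>3 + 6 p\<^sub>4\<close>; the terms other than
    \<open>p\<^sub>1^4 + 3 p\<^sub>2^2\<close> form a sum of definite binary forms in \<open>(x, p\<^sub>1)\<close> times \<open>x^2\<close>, \<open>x = r, s, t\<close>.\<close>
  define p where "p = r + s + t"
  have nn: "0 \<le> x ^ 2 * (6 * x ^ 2 + 8 * p * x + 6 * p ^ 2)" for x :: rat
  proof -
    have "6 * x ^ 2 + 8 * p * x + 6 * p ^ 2 = 4 * (x + p) ^ 2 + 2 * x ^ 2 + 2 * p ^ 2"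
      by algebra
    also have "\<dots> \<ge> 0" by simp
    finally have "0 \<le> 6 * x ^ 2 + 8 * p * x + 6 * p ^ 2" .
    then show ?thesis by simp
  qed
  have "p ^ 4 + 3 * (r ^ 2 + s ^ 2 + t ^ 2) ^ 2 + r ^ 2 * (6 * r ^ 2 + 8 * p * r + 6 * p ^ 2)
     + s ^ 2 * (6 * s ^ 2 + 8 * p * s + 6 * p ^ 2) + t ^ 2 * (6 * t ^ 2 + 8 * p * t + 6 * p ^ 2) = 0"
    using assms unfolding p_def by algebra
  moreover have "0 \<le> p ^ 4" by simp
  ultimately have "(r ^ 2 + s ^ 2 + t ^ 2) ^ 2 \<le> 0"
    using nn[of r] nn[of s] nn[of t] by linarith
  then have "r ^ 2 + s ^ 2 + t ^ 2 = 0" by simp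
  then show ?thesis
    by (smt (verit) zero_le_power2 power_eq_0_iff add_nonneg_eq_0_iff add_nonneg_nonneg)
qed

lemma degree_1_eq_smult_linear:
  fixes f :: "'a :: field poly"
  assumes "degree f = 1"
  obtains c r where "f = smult c [:- r, 1:]"
proof -
  obtain u v where "f = [:u, v:]" "v \<noteq> 0"
    using assms by (metis degree1_coeffs)
  then have "f = smult v [:- (- u / v), 1:]" by simp
  then show thesis by (rule that)
qed

lemma no_type_1_1_1_3:
  assumes "has_reducibility_type (trinomial 6 1 A B) [1, 1, 1, 3]"
  shows "B = 0"
proof -
  obtain fs where fs: "trinomial 6 1 A B = prod_list fs" "map degree fs = [1, 1, 1, 3]"
    using assms unfolding has_reducibility_type_def by metis
  then obtain f1 f2 f3 f4 where f: "fs = [f1, f2, f3, f4]" "degree f1 = 1" "degree f2 = 1"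
    "degree f3 = 1" "degree f4 = 3"
    by (auto simp: map_eq_Cons_conv)
  obtain c1 r where f1: "f1 = smult c1 [:- r, 1:]" using degree_1_eq_smult_linear[OF f(2)] .
  obtain c2 s where f2: "f2 = smult c2 [:- s, 1:]" using degree_1_eq_smult_linear[OF f(3)] .
  obtain c3 t where f3: "f3 = smult c3 [:- t, 1:]" using degree_1_eq_smult_linear[OF f(4)] .
  \<comment> \<open>The leading coefficients of the linear factors are absorbed into the cubic
    one.\<close>
  define g where "g = smult (c1 * c2 * c3) f4"
  have "degree g \<le> 3" unfolding g_def using f(5) by simp
  then have g: "g = [:coeff g 0, coeff g 1, coeff g 2, coeff g 3:]"
    by (intro poly_eqI) (auto simp: coeff_pCons eval_nat_numeral coeff_eq_0 split: nat.split)
  obtain g0 g1 g2 g3 where g: "g = [:g0, g1, g2, g3:]" using g by blast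
  have "trinomial 6 1 A B = [:- r, 1:] * ([:- s, 1:] * ([:- t, 1:] * g))"
    unfolding fs(1) f(1) f1 f2 f3 g_def
    by (simp only: prod_list.Cons prod_list.Nil mult_smult_left mult_smult_right smult_smult
        mult_1_left mult_1_right mult_ac)
  then have E: "[:B, A, 0, 0, 0, 0, 1:] = [:- r, 1:] * ([:- s, 1:] * ([:- t, 1:] * [:g0, g1, g2, g3:]))"
    unfolding trinomial_6_1 g .
  have B: "B = - (r * s * t * g0)"
    using arg_cong[OF E, of "\<lambda>p. coeff p 0"] by (simp add: mult_ac)
  define e1 e2 e3 where "e1 = r + s + t" and "e2 = r * s + r * t + s * t" and "e3 = r * s * t"
  \<comment> \<open>The coefficients of x^5, x^4, x^3 identify \<open>g2\<close>, \<open>g1\<close>,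
    \<open>g0\<close> with the complete homogeneous polynomials h1, h2, h3 in \<open>r\<close>,
    \<open>s\<close>, \<open>t\<close>; that of x^2 then says h4 = 0.\<close>
  have "g2 = e1"
    using E unfolding e1_def by (auto simp: algebra_simps)
  moreover have "g1 = e1 * g2 - e2"
    using E unfolding e1_def e2_def by (auto simp: algebra_simps)
  moreover have "g0 = e1 * g1 - e2 * g2 + e3"
    using E unfolding e1_def e2_def e3_def by (auto simp: algebra_simps)
  moreover have "0 = e1 * g0 - e2 * g1 + e3 * g2"
    using E unfolding e1_def e2_def e3_def by (auto simp: algebra_simps)
  ultimately have "r = 0"
    unfolding e1_def e2_def e3_def by (intro complete_homogeneous_4_eq_0D[of r s t]) algebra
  then show "B = 0"
    using B by simp
qed

theorem theorem4p1:
  shows "(\<exists>S :: (rat \<times> rat) set. infinite S \<and>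
            (\<forall>(A, B) \<in> S. A * B \<noteq> 0 \<and> has_reducibility_type (trinomial 6 1 A B) [1, 2, 3]) \<and>
            pairwise (\<lambda>(A, B) (A', B'). \<not> scaling_equivalent 6 1 A B A' B') S) \<and>
         \<not> (\<exists>A B :: rat. A * B \<noteq> 0 \<and> has_reducibility_type (trinomial 6 1 A B) [1, 1, 1, 3])"
proof -
  define G where "G = {(a, b). splitting_pair a b}"
  define h where "h = (\<lambda>(a, b). (b * cubic_const a b - 1, - (b * cubic_const a b)))"
  have "inj_on h G"
    unfolding inj_on_def G_def h_def using splitting_pair_unique by auto
  then have inf: "infinite (h ` G)"
    using infinite_splitting_pairs unfolding G_def by (simp add: finite_image_iff)
  have type_123: "A * B \<noteq> 0 \<and> has_reducibility_type (trinomial 6 1 A B) [1, 2, 3]"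
    if AB_in: "(A, B) \<in> h ` G" for A B
  proof -
    obtain a b where ab: "splitting_pair a b" and AB: "A = b * cubic_const a b - 1" "B = - (b * cubic_const a b)"
      using AB_in unfolding h_def G_def by auto
    have "A \<noteq> 0"
    proof
      assume "A = 0"
      \<comment> \<open>Here \<open>B = -1\<close>, so the trinomial would be x^6 - 1, with the
        second root -1.\<close>
      then have "poly (trinomial 6 1 A B) (-1) = 0"
        using AB unfolding trinomial_6_1 by simp
      then show False
        using trinomial_root_unique[OF ab] AB by fastforce
    qed
    moreover have "B \<noteq> 0"
      using quad_no_root[OF ab, of 0] cubic_no_root[OF ab, of 0] AB
      by (simp add: quad_def cubic_def)
    moreover have "has_reducibility_type (trinomial 6 1 A B) [1, 2, 3]"
      unfolding has_reducibility_type_def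
    proof (intro conjI exI)
      show "lead_coeff (trinomial 6 1 A B) = 1" unfolding trinomial_6_1 by simp
      show "trinomial 6 1 A B = prod_list [[:-1, 1:], quad a b, cubic a b]"
        using trinomial_factorization[OF ab] AB by simp
      have "irreducible [:-1, 1 :: rat:]"
        by (rule irreducible_linear_field_poly) simp
      then show "\<forall>f\<in>set [[:-1, 1:], quad a b, cubic a b]. irreducible f"
        using irreducible_quad[OF ab] irreducible_cubic[OF ab] by simp
    qed (simp_all add: quad_def cubic_def)
    ultimately show "A * B \<noteq> 0 \<and> has_reducibility_type (trinomial 6 1 A B) [1, 2, 3]" by simp
  qed
  have inequiv: "\<not> scaling_equivalent 6 1 A B A' B'"
    if AB_in: "(A, B) \<in> h ` G" and AB'_in: "(A', B') \<in> h ` G" and ne: "(A, B) \<noteq> (A', B')"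
    for A B A' B'
  proof
    assume sc: "scaling_equivalent 6 1 A B A' B'"
    obtain a b where ab: "splitting_pair a b" and AB: "A = b * cubic_const a b - 1" "B = - (b * cubic_const a b)"
      using AB_in unfolding h_def G_def by auto
    have AB': "A' + B' = -1"
      using AB'_in unfolding h_def G_def by auto
    obtain l where l: "l \<noteq> 0" "A' = A * l ^ 5" "B' = B * l ^ 6"
      using sc unfolding scaling_equivalent_def by auto
    \<comment> \<open>By \<open>AB'\<close>, the second trinomial has root 1; undoing the scaling
      turns it into the root \<open>1 / l\<close> of the first.\<close>
    have "poly (trinomial 6 1 A B) (1 / l) = (1 + A * l ^ 5 + B * l ^ 6) / l ^ 6"
      using l(1) unfolding trinomial_6_1 by (simp add: field_simps eval_nat_numeral)
    also have "\<dots> = 0" using AB' l by simp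
    finally have "1 / l = 1"
      using trinomial_root_unique[OF ab] unfolding AB by blast
    then show False
      using l ne by simp
  qed
  have "\<not> (\<exists>A B :: rat. A * B \<noteq> 0 \<and> has_reducibility_type (trinomial 6 1 A B) [1, 1, 1, 3])"
    using no_type_1_1_1_3 by (metis mult_zero_right)
  moreover have "\<forall>(A, B) \<in> h ` G. A * B \<noteq> 0 \<and> has_reducibility_type (trinomial 6 1 A B) [1, 2, 3]"
    using type_123 by blast
  moreover have "pairwise (\<lambda>(A, B) (A', B'). \<not> scaling_equivalent 6 1 A B A' B') (h ` G)"
    using inequiv unfolding pairwise_def by blast
  ultimately show ?thesis
    using inf by blast
qed

end
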